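(* Let $\mathsf R,\mathsf E$ be totally ordered finite sets with $|\mathsf R|=d\le n=|\mathsf E|$, let $\mathcal T$ be a triangulation of $\triangle_{d-1}\times\triangle_{n-1}$ with polyhedral matching field $(M_\sigma)$, let $A\in\{+,-\}^{\mathsf R\times\mathsf E}$ be a sign matrix, and let $\chi$ be the chirotope $\sigma\mapsto\operatorname{sign}(M_\sigma)\prod_{e\in M_\sigma}A_e$. Let $\rho\subseteq\mathsf E$ be any $(n-d+1)$-subset and let $T_\rho$ be the unique tree encoding a cell of $\mathcal T$ in which every node of $\rho$ has degree $1$ and every node of $\mathsf E\setminus\rho$ has degree $2$. Then there exist precisely two flippings of $\mathsf R$ such that every node of $\mathsf E\setminus\rho$ is incident to edges of different signs in $T_\rho$. In each case, the signs of the edges of $T_\rho$ incident to $\rho$ together give a signed cocircuit, supported on $\rho$, of the oriented matroid given by $\chi$.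
   Context: **Triangulations and matching fields.** A triangulation of $\triangle_{d-1}\times\triangle_{n-1}$ (with $\triangle_{k-1}=\operatorname{conv}\{\mathbf e_1,\dots,\mathbf e_k\}$) is a collection of full-dimensional simplices with vertices among the $(\mathbf e_i,\mathbf e_j)$, with union $\triangle_{d-1}\times\triangle_{n-1}$, any two intersecting in a common face. Identifying $(\mathbf e_i,\mathbf e_j)$ with the edge $(i,j)$ of $K_{\mathsf R,\mathsf E}$, each simplex (cell) becomes a spanning tree of $K_{\mathsf R,\mathsf E}$. For every $d$-subset $\sigma\subseteq\mathsf E$ there is exactly one perfect matching $M_\sigma$ between $\mathsf R$ and $\sigma$ contained in at least one of these trees; $(M_\sigma)$ is the polyhedral matching field. $\operatorname{sign}(M_\sigma)$ is the sign of the permutation $[d]\to\mathsf R\to\sigma\to[d]$ (order-preserving bijections at both ends, $M_\sigma$ in the middle). The map $\chi$, extended to an alternating map, is known to be the chirotope of a uniform oriented matroid. The existence and uniqueness of $T_\rho$ is a known fact (Postnikov). **Flippings.** To flip a node of $\mathsf R$ means to negate the row of $A$ indexed by that node. A flipping of $\mathsf R$ is a choice of which nodes to flip, i.e. a vector $S\in\{+,-\}^{\mathsf R}$; after flipping, the sign of an edge $(i,j)$ is $S_iA_{i,j}$. The sign vector on $\mathsf E$ obtained from a flipping has as its $j$-th entry, for $j\in\rho$, the sign of the unique edge of $T_\rho$ incident to $j$, and is $0$ on $\mathsf E\setminus\rho$. Signed cocircuits are those of the oriented matroid defined by $\chi$ in the standard sense (non-zero covectors of minimal support; in the realizable case, sign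 vectors of row space elements of minimal support). *)

theory Defs
  imports "HOL-Analysis.Analysis" "HOL-Combinatorics.Permutations"
begin

(* The node sets R and E are the finite linearly ordered types 'r and 'e; subgraphs of
   K_{R,E} are sets of pairs (i, j). *)

section \<open>Triangulations of products of simplices\<close>

definition std_simplex :: "(real ^ 'k) set" where
  "std_simplex = convex hull (range (\<lambda>i. axis i 1))"

definition edge_point :: "'r \<times> 'e \<Rightarrow> (real ^ 'r) \<times> (real ^ 'e)" where
  "edge_point = (\<lambda>(i, j). (axis i 1, axis j 1))"

(* The library predicate "triangulation" says that the family is finite, consists of
   simplices, and that any two members meet in a common face. *)
definition product_triangulation :: "((real ^ 'r) \<times> (real ^ 'e)) set set \<Rightarrow> bool" where
  "product_triangulation \<T> \<longleftrightarrow>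
     triangulation \<T> \<and>
     \<Union>\<T> = std_simplex \<times> std_simplex \<and>
     (\<forall>C\<in>\<T>. (int CARD('r) + int CARD('e) - 2) simplex C \<and>
        {v. v extreme_point_of C} \<subseteq> range edge_point)"

definition cell_tree :: "((real ^ 'r) \<times> (real ^ 'e)) set \<Rightarrow> ('r \<times> 'e) set" where
  "cell_tree C = {p. edge_point p extreme_point_of C}"

definition degree_E :: "('r \<times> 'e) set \<Rightarrow> 'e \<Rightarrow> nat" where
  "degree_E G j = card {i. (i, j) \<in> G}"

section \<open>Polyhedral matching field and its chirotope\<close>

definition perfect_matching :: "'e set \<Rightarrow> ('r \<times> 'e) set \<Rightarrow> bool" where
  "perfect_matching \<sigma> M \<longleftrightarrow>
     M \<subseteq> UNIV \<times> \<sigma> \<and> (\<forall>i. \<exists>!j. (i, j) \<in> M) \<and> (\<forall>j\<in>\<sigma>. \<exists>!i. (i, j) \<in> M)"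

(* Only meaningful for sets of cardinality CARD('r); there the description is unique. *)
definition matching_field ::
    "((real ^ 'r) \<times> (real ^ 'e)) set set \<Rightarrow> 'e set \<Rightarrow> ('r \<times> 'e) set" where
  "matching_field \<T> \<sigma> = (THE M. perfect_matching \<sigma> M \<and> (\<exists>C\<in>\<T>. M \<subseteq> cell_tree C))"

(* The order-preserving bijection from \<sigma> to {0..<card \<sigma>}. *)
definition position :: "'a::linorder set \<Rightarrow> 'a \<Rightarrow> nat" where
  "position \<sigma> x = card {y \<in> \<sigma>. y < x}"

(* [d] is {0..<d}; the permutation is extended by the identity to all of nat. *)
definition matching_sign :: "'e set \<Rightarrow> ('r::{finite,linorder} \<times> 'e::{finite,linorder}) set \<Rightarrow> int" where
  "matching_sign \<sigma> M =
     sign (\<lambda>k. if k < CARD('r)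
               then position \<sigma> (THE j. (sorted_list_of_set (UNIV :: 'r set) ! k, j) \<in> M)
               else k)"

(* f gives the values of the map on increasing d-tuples. *)
definition alternating_extension :: "nat \<Rightarrow> ('e::linorder set \<Rightarrow> int) \<Rightarrow> 'e list \<Rightarrow> int" where
  "alternating_extension d f xs =
     (if length xs = d \<and> distinct xs
      then sign (\<lambda>k. if k < d then position (set xs) (xs ! k) else k) * f (set xs)
      else 0)"

definition triangulation_chirotope ::
    "((real ^ 'r::{finite,linorder}) \<times> (real ^ 'e::{finite,linorder})) set set \<Rightarrow>
     ('r \<Rightarrow> 'e \<Rightarrow> int) \<Rightarrow> 'e list \<Rightarrow> int" where
  "triangulation_chirotope \<T> A =
     alternating_extension CARD('r)
       (\<lambda>\<sigma>. matching_sign \<sigma> (matching_field \<T> \<sigma>) * (\<Prod>(i, j)\<in>matching_field \<T> \<sigma>. A i j))"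

section \<open>Covectors and signed cocircuits of the oriented matroid of a chirotope\<close>

(* Sign vectors are functions with values in {-1, 0, 1}. *)

definition supp :: "('e \<Rightarrow> int) \<Rightarrow> 'e set" where
  "supp X = {e. X e \<noteq> 0}"

definition sv_compose :: "('e \<Rightarrow> int) \<Rightarrow> ('e \<Rightarrow> int) \<Rightarrow> 'e \<Rightarrow> int" where
  "sv_compose X Y = (\<lambda>e. if X e \<noteq> 0 then X e else Y e)"

(* The covectors of the rank d oriented matroid with chirotope chi are the compositions of
   the sign vectors e \<mapsto> \<plusminus>chi(x_1, ..., x_{d-1}, e); the zero vector is the empty
   composition.  In the realizable case e \<mapsto> det(x_1, ..., x_{d-1}, e) is the row space
   element that vanishes on the hyperplane spanned by x_1, ..., x_{d-1}.  The explicit sign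
   s is needed: for d \<le> 2 reordering the x_i does not produce the negatives. *)
inductive_set covectors :: "nat \<Rightarrow> ('e list \<Rightarrow> int) \<Rightarrow> ('e \<Rightarrow> int) set"
  for d :: nat and chi :: "'e list \<Rightarrow> int" where
  zero: "(\<lambda>_. 0) \<in> covectors d chi"
| compose: "\<lbrakk>s \<in> {1, -1}; length xs = d - 1; Y \<in> covectors d chi\<rbrakk>
    \<Longrightarrow> sv_compose (\<lambda>e. s * chi (xs @ [e])) Y \<in> covectors d chi"

definition signed_cocircuits :: "nat \<Rightarrow> ('e list \<Rightarrow> int) \<Rightarrow> ('e \<Rightarrow> int) set" where
  "signed_cocircuits d chi =
     {X \<in> covectors d chi. supp X \<noteq> {} \<and>
        (\<forall>Z\<in>covectors d chi. supp Z \<noteq> {} \<longrightarrow> supp Z \<subseteq> supp X \<longrightarrow> supp Z = supp X)}"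

section \<open>Flippings\<close>

definition flippings :: "('r \<Rightarrow> int) set" where
  "flippings = {S. \<forall>i. S i \<in> {1, -1}}"

definition edge_sign :: "('r \<Rightarrow> 'e \<Rightarrow> int) \<Rightarrow> ('r \<Rightarrow> int) \<Rightarrow> 'r \<Rightarrow> 'e \<Rightarrow> int" where
  "edge_sign A S i j = S i * A i j"

definition alternating_flippings ::
    "('r \<Rightarrow> 'e \<Rightarrow> int) \<Rightarrow> ('r \<times> 'e) set \<Rightarrow> 'e set \<Rightarrow> ('r \<Rightarrow> int) set" where
  "alternating_flippings A G \<rho> =
     {S \<in> flippings. \<forall>j. j \<notin> \<rho> \<longrightarrow>
        (\<exists>i i'. (i, j) \<in> G \<and> (i', j) \<in> G \<and> edge_sign A S i j \<noteq> edge_sign A S i' j)}"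

definition flipping_vector ::
    "('r \<Rightarrow> 'e \<Rightarrow> int) \<Rightarrow> ('r \<times> 'e) set \<Rightarrow> 'e set \<Rightarrow> ('r \<Rightarrow> int) \<Rightarrow> 'e \<Rightarrow> int" where
  "flipping_vector A G \<rho> S j =
     (if j \<in> \<rho> then edge_sign A S (THE i. (i, j) \<in> G) j else 0)"

end

theory Submission
  imports Defs
begin

text \<open>Since the nodes outside \<open>\<rho>\<close> have degree 2, they act as the edges of a tree on \<open>R\<close>, and
  alternation prescribes the ratio of the signs of \<open>S\<close> along each such edge; hence there are exactly two
  flippings. Rooting this tree at \<open>r\<close> matches every other node of \<open>R\<close> with the edge towards \<open>r\<close>,
  and adding a leaf \<open>e \<in> \<rho>\<close> at \<open>r\<close> gives the matching of \<open>(E - \<rho>) \<union> {e}\<close>. Moving the root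
  to a neighbour multiplies the permutation by a transposition, and alternation of \<open>S\<close> turns the
  change in the product of matrix entries into the compensating sign. So
  \<open>\<chi>(E - \<rho>, e)\<close> and the entry of the flipping vector at \<open>e\<close> agree up to a sign that does not
  depend on \<open>e\<close>. Its support is minimal because \<open>\<chi>\<close> never vanishes on distinct arguments.\<close>

section \<open>Cells as spanning trees\<close>

lemma inj_edge_point: "inj (edge_point :: 'r::finite \<times> 'e::finite \<Rightarrow> _)"
  by (auto simp: inj_on_def edge_point_def axis_eq_axis)

lemma extreme_points_cell:
  assumes "product_triangulation \<T>" "C \<in> \<T>"
  shows "{v. v extreme_point_of C} = edge_point ` cell_tree C"
proof -
  have "{v. v extreme_point_of C} \<subseteq> range edge_point"
    using assms unfolding product_triangulation_def by simp
  then show ?thesis unfolding cell_tree_def by auto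
qed

text \<open>An affinely independent set spanning a simplex is its set of extreme points, so it must
  be the one coming from \<open>cell_tree C\<close>.\<close>

lemma cell_affine_independent:
  assumes "product_triangulation \<T>" "C \<in> \<T>"
  shows "\<not> affine_dependent (edge_point ` cell_tree C)"
    and "C = convex hull (edge_point ` cell_tree C)"
proof -
  obtain S where S: "\<not> affine_dependent S" "C = convex hull S"
    using assms unfolding product_triangulation_def triangulation_def simplex_def by blast
  have "edge_point ` cell_tree C = S"
    using extreme_points_cell[OF assms] extreme_point_of_convex_hull_affine_independent[OF S(1)] S(2)
    by auto
  with S show "\<not> affine_dependent (edge_point ` cell_tree C)"
    and "C = convex hull (edge_point ` cell_tree C)" by simp_all
qed

text \<open>Only the \<open>R\<close>-side of a cut is recorded, so isolated \<open>E\<close>-nodes are ignored.\<close>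

definition R_connected :: "('r \<times> 'e) set \<Rightarrow> bool" where
  "R_connected G \<longleftrightarrow>
     (\<forall>U. U \<noteq> {} \<longrightarrow> (\<forall>i i' j. (i, j) \<in> G \<longrightarrow> (i', j) \<in> G \<longrightarrow> i \<in> U \<longrightarrow> i' \<in> U) \<longrightarrow> U = UNIV)"

lemma R_connectedD:
  assumes "R_connected G" "i\<^sub>0 \<in> U"
    and "\<And>i i' j. (i, j) \<in> G \<Longrightarrow> (i', j) \<in> G \<Longrightarrow> i \<in> U \<Longrightarrow> i' \<in> U"
  shows "i \<in> U"
  using assms unfolding R_connected_def by blast

lemma inner_edge_point:
  "inner (a, b) (edge_point (i, j)) = a $ i + b $ j"
  by (simp add: edge_point_def inner_axis)

text \<open>A cell spans the hyperplane on which both coordinate sums agree. A set \<open>U\<close> closed under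
  adjacency gives a functional (coordinates in \<open>U\<close> minus coordinates of the neighbours of \<open>U\<close>)
  that vanishes on the cell, hence on every \<open>edge_point\<close>.\<close>

lemma cell_tree_R_connected:
  fixes \<T> :: "((real ^ 'r) \<times> (real ^ 'e)) set set"
  assumes "product_triangulation \<T>" "C \<in> \<T>"
  shows "R_connected (cell_tree C)"
  unfolding R_connected_def
proof (intro allI impI)
  fix U :: "'r set"
  assume "U \<noteq> {}"
    and cl: "\<forall>i i' j. (i, j) \<in> cell_tree C \<longrightarrow> (i', j) \<in> cell_tree C \<longrightarrow> i \<in> U \<longrightarrow> i' \<in> U"
  define V where "V = {j. \<exists>i\<in>U. (i, j) \<in> cell_tree C}"
  define a :: "(real ^ 'r) \<times> (real ^ 'e)"
    where "a = (\<chi> i. of_bool (i \<in> U), \<chi> j. - of_bool (j \<in> V))"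
  define b :: "(real ^ 'r) \<times> (real ^ 'e)" where "b = (\<chi> i. 1, \<chi> j. - 1)"
  \<comment> \<open>Value 1 on every point of \<open>?P\<close> keeps the origin off its affine
    hull, so adjoining 0 turns affine dimension into linear dimension, larger by 1.\<close>
  define u :: "(real ^ 'r) \<times> (real ^ 'e)" where "u = (\<chi> i. 1, 0)"
  let ?P = "edge_point ` cell_tree C"
  have "i \<in> U \<longleftrightarrow> j \<in> V" if "(i, j) \<in> cell_tree C" for i j
    using cl that unfolding V_def by blast
  then have aP: "?P \<subseteq> {z. inner a z = 0}"
    by (auto simp: a_def inner_edge_point)
  have bP: "?P \<subseteq> {z. inner b z = 0}"
    by (auto simp: b_def inner_edge_point)
  have uP: "?P \<subseteq> {z. inner u z = 1}"
    by (auto simp: u_def inner_edge_point)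
  have "affine hull ?P \<subseteq> {z. inner u z = 1}"
    by (intro hull_minimal uP affine_hyperplane)
  then have z: "0 \<notin> affine hull ?P" by auto
  have "(int CARD('r) + int CARD('e) - 2) simplex C"
    using assms unfolding product_triangulation_def by blast
  then have "aff_dim C = int CARD('r) + int CARD('e) - 2"
    by (rule aff_dim_simplex)
  then have "aff_dim ?P = int CARD('r) + int CARD('e) - 2"
    using arg_cong[OF cell_affine_independent(2)[OF assms], of aff_dim]
    by (simp only: aff_dim_convex_hull)
  then have "aff_dim (insert 0 ?P) = int CARD('r) + int CARD('e) - 1"
    using z by (simp add: aff_dim_insert)
  moreover have "aff_dim (insert 0 ?P) = int (dim (insert 0 ?P))"
    by (rule aff_dim_zero) (simp add: hull_inc)
  moreover have "dim (insert 0 ?P) = dim (span ?P)"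
    by (metis dim_span span_insert_0)
  ultimately have dimP: "int (dim (span ?P)) = int CARD('r) + int CARD('e) - 1"
    by simp
  have "b \<noteq> 0" by (simp add: b_def zero_prod_def vec_eq_iff)
  then have "dim {z. inner b z = 0} = CARD('r) + CARD('e) - 1"
    by (simp add: dim_hyperplane)
  then have "span ?P = {z. inner b z = 0}"
    using dimP bP
    by (intro subspace_dim_equal span_minimal) (auto simp: subspace_hyperplane)
  moreover have "span ?P \<subseteq> {z. inner a z = 0}"
    by (intro span_minimal aP subspace_hyperplane)
  moreover have "inner b (edge_point (i, j)) = 0" for i j
    by (simp add: b_def inner_edge_point)
  ultimately have a0: "inner a (edge_point (i, j)) = 0" for i j by blast
  \<comment> \<open>\<open>a0\<close> covers all pairs, not only edges of the cell, so membership in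
    \<open>U\<close> is the same for every \<open>i\<close>.\<close>
  have "i \<in> U \<longleftrightarrow> j \<in> V" for i j
    using a0[of i j] unfolding a_def inner_edge_point by (simp add: of_bool_def split: if_splits)
  with \<open>U \<noteq> {}\<close> show "U = UNIV" by blast
qed

section \<open>Uniqueness of the matchings\<close>

lemma perfect_matching_function:
  assumes "perfect_matching \<sigma> M"
  obtains m where "M = (\<lambda>i. (i, m i)) ` UNIV" "bij_betw m UNIV \<sigma>"
proof -
  from assms obtain m where m: "(i, j) \<in> M \<longleftrightarrow> j = m i" for i j
    unfolding perfect_matching_def by metis
  have "M = (\<lambda>i. (i, m i)) ` UNIV" using m by auto
  moreover have "bij_betw m UNIV \<sigma>"
    using assms m unfolding perfect_matching_def bij_betw_def inj_on_def by blast
  ultimately show ?thesis using that by blast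
qed

lemma perfect_matching_graph:
  assumes "bij_betw m UNIV \<sigma>"
  shows "perfect_matching \<sigma> (range (\<lambda>i. (i, m i)))"
  using assms unfolding perfect_matching_def bij_betw_def inj_on_def by auto

text \<open>The barycentre of the edge points of any perfect matching onto \<sigma>. The formula
  mentions no matching, so all of them share this point.\<close>

definition matching_centre :: "'e set \<Rightarrow> (real ^ 'r) \<times> (real ^ 'e)" where
  "matching_centre \<sigma> =
     (\<Sum>i\<in>UNIV. axis i (1 / CARD('r)), \<Sum>j\<in>\<sigma>. axis j (1 / CARD('r)))"

lemma matching_centre_in_rel_interior:
  fixes M :: "('r::finite \<times> 'e::finite) set"
  assumes "perfect_matching \<sigma> M"
  shows "(matching_centre \<sigma> :: (real ^ 'r) \<times> _) \<in> rel_interior (convex hull (edge_point ` M))"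
proof -
  obtain m where M: "M = range (\<lambda>i. (i, m i))" and m: "bij_betw m UNIV \<sigma>"
    using perfect_matching_function[OF assms] by metis
  have inj: "inj (\<lambda>i. edge_point (i, m i))"
    by (auto simp: inj_on_def edge_point_def axis_eq_axis)
  have P: "edge_point ` M = range (\<lambda>i. edge_point (i, m i))" using M by auto
  have "(\<Sum>x\<in>edge_point ` M. (1 / real CARD('r)) *\<^sub>R x)
      = (\<Sum>i\<in>UNIV. (1 / real CARD('r)) *\<^sub>R edge_point (i, m i))"
    unfolding P by (simp add: sum.reindex[OF inj])
  also have "\<dots> = (\<Sum>i\<in>UNIV. (axis i (1 / CARD('r)), axis (m i) (1 / CARD('r))))"
    by (intro sum.cong) (auto simp: edge_point_def vec_eq_iff axis_def)
  also have "\<dots> = matching_centre \<sigma>"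
    unfolding matching_centre_def sum.reindex_bij_betw[OF m, symmetric]
    by (simp add: sum_prod)
  finally have "(\<Sum>x\<in>edge_point ` M. (1 / real CARD('r)) *\<^sub>R x) = matching_centre \<sigma>" .
  moreover have "card (edge_point ` M) = CARD('r)"
    unfolding P using card_image[OF inj] by simp
  ultimately show ?thesis
    by (intro subsetD[OF explicit_subset_rel_interior_convex_hull_minimal] CollectI
        exI[of _ "\<lambda>_. 1 / real CARD('r)"]) auto
qed

text \<open>The centre lies in the relative interior of the simplices spanned by both matchings, so each
  face of a cell that contains one of them contains the other.\<close>

lemma perfect_matching_subset:
  fixes M M' :: "('r::finite \<times> 'e::finite) set"
  assumes \<T>: "product_triangulation \<T>" and C: "C \<in> \<T>" "C' \<in> \<T>"
    and M: "perfect_matching \<sigma> M" "M \<subseteq> cell_tree C"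
    and M': "perfect_matching \<sigma> M'" "M' \<subseteq> cell_tree C'"
  shows "M \<subseteq> M'"
proof -
  let ?H = "convex hull (edge_point ` M)" and ?H' = "convex hull (edge_point ` M')"
  let ?p = "matching_centre \<sigma> :: (real ^ 'r) \<times> (real ^ 'e)"
  have p: "?p \<in> rel_interior ?H" "?p \<in> ?H" "?p \<in> ?H'"
    using matching_centre_in_rel_interior M(1) M'(1) rel_interior_subset by blast+
  have sub: "?H \<subseteq> C" "?H' \<subseteq> C'"
    using cell_affine_independent(2)[OF \<T>] C M(2) M'(2) hull_mono image_mono by metis+
  have face: "C \<inter> C' face_of C" "C \<inter> C' face_of C'"
    using \<T> C unfolding product_triangulation_def triangulation_def by (metis inf_commute)+
  \<comment> \<open>The face contains the centre, a relative interior point of \<open>?H\<close>,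
    and hence all of \<open>?H\<close>.\<close>
  have HF: "?H \<subseteq> C \<inter> C'"
    by (rule subset_of_face_of[OF face(1) sub(1)]) (use p sub in blast)
  \<comment> \<open>Any set of vertices of a simplex spans a face.\<close>
  have "?H' face_of C'"
    using cell_affine_independent[OF \<T> C(2)] M'(2) face_of_convex_hull_affine_independent
      image_mono by metis
  then have HH: "?H \<subseteq> ?H'"
    by (rule subset_of_face_of) (use p HF in auto)
  show "M \<subseteq> M'"
  proof
    \<comment> \<open>Being a vertex passes from \<open>C\<close> to the common face, from there to
      \<open>C'\<close>, and then to \<open>?H'\<close>, whose vertices are edge points of
      \<open>M'\<close>.\<close>
    fix x assume "x \<in> M"
    then have "edge_point x extreme_point_of C" and xH: "edge_point x \<in> ?H"
      using M(2) by (auto simp: cell_tree_def intro: hull_inc)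
    then have "edge_point x extreme_point_of C'"
      using face HF extreme_point_of_face by blast
    then have "edge_point x extreme_point_of ?H'"
      using extreme_point_of_face[OF \<open>?H' face_of C'\<close>] HH xH by blast
    then have "edge_point x \<in> edge_point ` M'" by (rule extreme_point_of_convex_hull)
    then show "x \<in> M'" using inj_edge_point by (auto dest: injD)
  qed
qed

text \<open>Inclusion holds in both directions by symmetry, so the definite description denotes
  whatever matching is exhibited in a cell.\<close>

lemma matching_field_eq:
  assumes "product_triangulation \<T>" "C \<in> \<T>" "perfect_matching \<sigma> M" "M \<subseteq> cell_tree C"
  shows "matching_field \<T> \<sigma> = M"
  unfolding matching_field_def
  using assms perfect_matching_subset by (intro the_equality) blast+

section \<open>Rooted matchings and alternating flippings\<close>

text \<open>The two halves of the conclusion are built together by growing the reached set from \<open>r\<close>: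
  a newly reached node is matched to the \<open>'e\<close>-node through which it is reached, and its sign is
  chosen so that this \<open>'e\<close>-node sees different signs.\<close>

lemma rooted_matching_with_alternating_flipping:
  fixes G :: "('r::finite \<times> 'e) set" and A :: "'r \<Rightarrow> 'e \<Rightarrow> int"
  assumes conn: "R_connected G" and deg: "\<And>j. degree_E G j \<le> 2"
    and A: "\<forall>i j. A i j \<in> {1, -1}"
  shows "\<exists>N S. S \<in> flippings \<and> inj_on N (- {r}) \<and>
    (\<forall>i. i \<noteq> r \<longrightarrow> (i, N i) \<in> G \<and>
       (\<exists>a b. (a, N i) \<in> G \<and> (b, N i) \<in> G \<and> edge_sign A S a (N i) \<noteq> edge_sign A S b (N i)))"
proof -
  \<comment> \<open>Keeping all neighbours of used \<open>'e\<close>-nodes inside \<open>U\<close>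
    makes \<open>N\<close> injective: a node leading out of \<open>U\<close> cannot have been
    used.\<close>
  define Q where "Q = (\<lambda>U N S. S \<in> flippings \<and> inj_on N (U - {r}) \<and>
      (\<forall>i\<in>U - {r}. (i, N i) \<in> G \<and> {k. (k, N i) \<in> G} \<subseteq> U \<and>
         (\<exists>a b. (a, N i) \<in> G \<and> (b, N i) \<in> G \<and>
            edge_sign A S a (N i) \<noteq> edge_sign A S b (N i))))"
  have grow: "\<exists>U N S. card U = Suc k \<and> r \<in> U \<and> Q U N S" if "Suc k \<le> CARD('r)" for k
    using that
  proof (induction k)
    case 0
    have "card {r} = Suc 0 \<and> r \<in> {r} \<and> Q {r} (\<lambda>_. undefined) (\<lambda>_. 1)"
      by (simp add: Q_def flippings_def)
    then show ?case by (intro exI)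
  next
    case (Suc k)
    then have "\<exists>U N S. card U = Suc k \<and> r \<in> U \<and> Q U N S" by simp
    then obtain U N S where U: "card U = Suc k" "r \<in> U" and Q: "Q U N S" by blast
    have "U \<noteq> UNIV" using U Suc.prems by auto
    then obtain i i' j where ij: "(i, j) \<in> G" "(i', j) \<in> G" "i \<in> U" "i' \<notin> U"
      using R_connectedD[OF conn U(2)] by blast
    have "i \<noteq> i'" using ij by auto
    then have "{i, i'} \<subseteq> {k. (k, j) \<in> G}" "card {i, i'} = 2"
      using ij by simp_all
    \<comment> \<open>The degree bound leaves \<open>j\<close> no third neighbour, so the enlarged
      set contains all neighbours of \<open>j\<close>.\<close>
    then have ends: "{k. (k, j) \<in> G} = {i, i'}"
      using deg[of j] card_seteq[of "{k. (k, j) \<in> G}" "{i, i'}"]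
      by (simp add: degree_E_def)
    define N' where "N' = N(i' := j)"
    \<comment> \<open>As \<open>A i' j\<close> squares to 1, the edge from \<open>i'\<close> to
      \<open>j\<close> gets the sign opposite to that of the edge from \<open>i\<close>.\<close>
    define S' where "S' = S(i' := - S i * A i j * A i' j)"
    have S: "S k \<in> {1, -1}" for k using Q by (simp add: Q_def flippings_def)
    have "S' k \<in> {1, -1}" for k
      using S[of k] S[of i] A[rule_format, of i j] A[rule_format, of i' j] by (auto simp: S'_def)
    then have "S' \<in> flippings" by (simp add: flippings_def)
    moreover have new: "N k \<noteq> j" if "k \<in> U - {r}" for k
    proof
      assume "N k = j"
      moreover have "{l. (l, N k) \<in> G} \<subseteq> U" using Q that unfolding Q_def by simp
      ultimately show False using ij(2,4) by auto
    qed
    have "inj_on N' (insert i' U - {r})"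
    proof -
      have "inj_on N' (U - {r}) \<longleftrightarrow> inj_on N (U - {r})"
        by (rule inj_on_cong) (use ij(4) in \<open>auto simp: N'_def\<close>)
      then have "inj_on N' (U - {r})" using Q by (simp add: Q_def)
      moreover have "N' i' \<notin> N' ` (U - {r})"
      proof
        assume "N' i' \<in> N' ` (U - {r})"
        then obtain k where "k \<in> U - {r}" "N' i' = N' k" by blast
        with new[of k] ij(4) show False by (auto simp: N'_def split: if_splits)
      qed
      moreover have "insert i' U - {r} = insert i' (U - {r})" using ij(4) U(2) by auto
      ultimately show ?thesis by auto
    qed
    moreover have "(k, N' k) \<in> G \<and> {l. (l, N' k) \<in> G} \<subseteq> insert i' U \<and>
       (\<exists>a b. (a, N' k) \<in> G \<and> (b, N' k) \<in> G \<and>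
            edge_sign A S' a (N' k) \<noteq> edge_sign A S' b (N' k))"
      if "k \<in> insert i' U - {r}" for k
    proof (cases "k = i'")
      case True
      have "edge_sign A S' i j \<noteq> edge_sign A S' i' j"
        using S[of i] A[rule_format, of i j] A[rule_format, of i' j] \<open>i \<noteq> i'\<close> by (auto simp: edge_sign_def S'_def)
      moreover have "N' k = j" using True by (simp add: N'_def)
      ultimately show ?thesis using True ij ends by auto
    next
      case False
      with that have k: "k \<in> U - {r}" by auto
      then have *: "(k, N k) \<in> G" "{l. (l, N k) \<in> G} \<subseteq> U"
          "\<exists>a b. (a, N k) \<in> G \<and> (b, N k) \<in> G \<and>
            edge_sign A S a (N k) \<noteq> edge_sign A S b (N k)"
        using Q unfolding Q_def by simp_all
      then obtain a b where ab: "(a, N k) \<in> G" "(b, N k) \<in> G"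
         "edge_sign A S a (N k) \<noteq> edge_sign A S b (N k)"
        by blast
      \<comment> \<open>The new node is no neighbour of \<open>N k\<close>, so changing its sign
        leaves the earlier alternation intact.\<close>
      with * ij(4) have "a \<noteq> i'" "b \<noteq> i'" by auto
      with ab(3) have "edge_sign A S' a (N k) \<noteq> edge_sign A S' b (N k)"
        by (simp add: edge_sign_def S'_def)
      moreover have "N' k = N k" using False by (simp add: N'_def)
      ultimately show ?thesis using *(1,2) ab(1,2) by auto
    qed
    ultimately have "Q (insert i' U) N' S'" unfolding Q_def by simp
    moreover have "card (insert i' U) = Suc (Suc k)" using U ij(4) by simp
    ultimately show ?case using U(2) by blast
  qed
  obtain U N S where "card U = CARD('r)" "Q U N S"
    using grow[of "CARD('r) - 1"] zero_less_card_finite[where 'a = 'r] by auto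
  then have "U = UNIV" using card_subset_eq[of UNIV U] by simp
  with \<open>Q U N S\<close> have Q: "Q UNIV N S" by simp
  show ?thesis
    by (intro exI[of _ N] exI[of _ S]) (use Q in \<open>simp add: Q_def Compl_eq_Diff_UNIV\<close>)
qed

section \<open>Values of the chirotope\<close>

text \<open>\<open>q\<close> read as a permutation of positions through the increasing enumeration
  of \<open>'r\<close>, the encoding used in \<open>matching_sign\<close>.\<close>

definition index_perm :: "('r::{finite,linorder} \<Rightarrow> nat) \<Rightarrow> nat \<Rightarrow> nat" where
  "index_perm q = (\<lambda>k. if k < CARD('r) then q (sorted_list_of_set (UNIV :: 'r set) ! k) else k)"

lemma bij_betw_sorted_UNIV:
  "bij_betw ((!) (sorted_list_of_set (UNIV :: 'r::{finite,linorder} set))) {..<CARD('r)} UNIV"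
  by (rule bij_betw_nth) simp_all

lemma permutes_if_bij_betw:
  fixes d :: nat
  assumes "bij_betw f {..<d} {..<d}"
  shows "(\<lambda>k. if k < d then f k else k) permutes {..<d}"
proof (rule bij_imp_permutes)
  show "bij_betw (\<lambda>k. if k < d then f k else k) {..<d} {..<d}"
    using assms by (rule bij_betw_cong[THEN iffD1, rotated]) simp
qed simp

lemma index_perm_permutes:
  fixes q :: "'r::{finite,linorder} \<Rightarrow> nat"
  assumes "bij_betw q UNIV {..<CARD('r)}"
  shows "index_perm q permutes {..<CARD('r)}"
  unfolding index_perm_def
  by (rule permutes_if_bij_betw)
    (use bij_betw_trans[OF bij_betw_sorted_UNIV assms] in \<open>simp add: comp_def\<close>)



text \<open>Swapping two nodes amounts to precomposing with the transposition of their
  ranks.\<close>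

lemma sign_index_perm_transpose:
  fixes q :: "'r::{finite,linorder} \<Rightarrow> nat"
  assumes q: "bij_betw q UNIV {..<CARD('r)}" and "r \<noteq> r'"
  shows "sign (index_perm (q \<circ> Transposition.transpose r r')) = - sign (index_perm q)"
proof -
  let ?L = "sorted_list_of_set (UNIV :: 'r set)"
  have inj: "inj_on ((!) ?L) {..<CARD('r)}" and "(!) ?L ` {..<CARD('r)} = UNIV"
    using bij_betw_sorted_UNIV[where 'r = 'r] by (auto simp: bij_betw_def)
  then have "r \<in> (!) ?L ` {..<CARD('r)}" "r' \<in> (!) ?L ` {..<CARD('r)}" by auto
  then obtain k k' where k: "k < CARD('r)" "?L ! k = r" "k' < CARD('r)" "?L ! k' = r'"
    by auto
  have "k \<noteq> k'" using k assms(2) by auto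
  have "Transposition.transpose r r' (?L ! l) = ?L ! Transposition.transpose k k' l" if "l < CARD('r)" for l
  proof (cases "l = k \<or> l = k'")
    case True
    then show ?thesis using k by auto
  next
    case False
    then have "?L ! l \<noteq> r" "?L ! l \<noteq> r'"
      using inj that k by (metis inj_onD lessThan_iff)+
    with False show ?thesis by simp
  qed
  moreover have "Transposition.transpose k k' l < CARD('r) \<longleftrightarrow> l < CARD('r)" for l
    using k by (auto simp: Transposition.transpose_def)
  moreover have "Transposition.transpose k k' l = l" if "\<not> l < CARD('r)" for l
    using k that by (auto simp: Transposition.transpose_def)
  ultimately have "index_perm (q \<circ> Transposition.transpose r r') = index_perm q \<circ> Transposition.transpose k k'"
    by (simp add: index_perm_def fun_eq_iff)
  moreover have "permutation (index_perm q)"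
    using index_perm_permutes[OF q] permutes_imp_permutation by blast
  ultimately show ?thesis
    using \<open>k \<noteq> k'\<close> by (simp add: sign_compose permutation_swap_id sign_swap_id)
qed

lemma bij_betw_position:
  assumes "finite \<sigma>"
  shows "bij_betw (position \<sigma>) \<sigma> {..<card \<sigma>}"
proof -
  have less: "position \<sigma> x < position \<sigma> y" if "x \<in> \<sigma>" "x < y" for x y
    unfolding position_def using that assms by (intro psubset_card_mono) auto
  then have inj: "inj_on (position \<sigma>) \<sigma>"
    by (intro linorder_inj_onI) (auto simp: less_imp_neq)
  have "position \<sigma> x < card \<sigma>" if "x \<in> \<sigma>" for x
    unfolding position_def using that assms by (intro psubset_card_mono) auto
  then have "position \<sigma> ` \<sigma> \<subseteq> {..<card \<sigma>}" by auto
  then have "position \<sigma> ` \<sigma> = {..<card \<sigma>}"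
    by (rule card_subset_eq[rotated]) (simp_all add: card_image inj)
  with inj show ?thesis by (simp add: bij_betw_def)
qed

text \<open>The reordering of \<open>ys\<close> and the sorting of the matched set cancel: only the position of the
  partner of each node inside \<open>ys\<close> matters.\<close>

lemma triangulation_chirotope_eq:
  fixes \<T> :: "((real ^ 'r::{finite,linorder}) \<times> (real ^ 'e::{finite,linorder})) set set"
    and q :: "'r \<Rightarrow> nat"
  assumes \<T>: "product_triangulation \<T>" "C \<in> \<T>"
    and ys: "distinct ys" "length ys = CARD('r)"
    and q: "bij_betw q UNIV {..<CARD('r)}"
    and G: "\<And>i. (i, ys ! q i) \<in> cell_tree C"
  shows "triangulation_chirotope \<T> A ys = sign (index_perm q) * (\<Prod>i\<in>UNIV. A i (ys ! q i))"
proof -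
  let ?d = "CARD('r)" and ?L = "sorted_list_of_set (UNIV :: 'r set)"
  have nth: "bij_betw ((!) ys) {..<?d} (set ys)"
    by (rule bij_betw_nth) (use ys in auto)
  let ?m = "\<lambda>i. ys ! q i"
  let ?M = "range (\<lambda>i. (i, ?m i))"
  have m: "bij_betw ?m UNIV (set ys)"
    using bij_betw_trans[OF q nth] by (simp add: comp_def)
  have mf: "matching_field \<T> (set ys) = ?M"
    by (rule matching_field_eq[OF \<T> perfect_matching_graph[OF m]]) (use G in auto)
  have card: "card (set ys) = ?d" using ys distinct_card by metis
  define \<pi> where "\<pi> = (\<lambda>k. if k < ?d then position (set ys) (ys ! k) else k)"
  have "bij_betw (\<lambda>k. position (set ys) (ys ! k)) {..<?d} {..<?d}"
    using bij_betw_trans[OF nth bij_betw_position] card by (simp add: comp_def)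
  then have "permutation \<pi>"
    unfolding \<pi>_def using permutes_if_bij_betw permutes_imp_permutation by blast
  moreover have "permutation (index_perm q)"
    using index_perm_permutes[OF q] permutes_imp_permutation by blast
  ultimately have "sign (\<pi> \<circ> index_perm q) = sign \<pi> * sign (index_perm q)"
    by (rule sign_compose)
  \<comment> \<open>The rank of a node's partner is found by taking its slot in \<open>ys\<close>
    and then sorting \<open>ys\<close> by \<pi>.\<close>
  moreover have "matching_sign (set ys) ?M = sign (\<pi> \<circ> index_perm q)"
  proof -
    have "(THE j. (i, j) \<in> ?M) = ?m i" for i by (rule the_equality) auto
    moreover have "q i < ?d" for i using q by (auto simp: bij_betw_def)
    ultimately have "(\<lambda>k. if k < ?d then position (set ys) (THE j. (?L ! k, j) \<in> ?M) else k)
        = \<pi> \<circ> index_perm q"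
      by (auto simp: fun_eq_iff \<pi>_def index_perm_def)
    then show ?thesis unfolding matching_sign_def by simp
  qed
  \<comment> \<open>\<open>sign \<pi>\<close> comes once from the alternating extension and once
    from the matching sign, and it squares to 1.\<close>
  ultimately have "sign \<pi> * matching_sign (set ys) ?M = sign (index_perm q)"
    by (simp add: mult.assoc[symmetric])
  moreover have "(\<Prod>(i, j)\<in>?M. A i j) = (\<Prod>i\<in>UNIV. A i (?m i))"
    by (subst prod.reindex) (auto simp: inj_on_def)
  ultimately show ?thesis
    using ys unfolding triangulation_chirotope_def alternating_extension_def mf
    by (simp add: \<pi>_def[symmetric] mult.assoc[symmetric])
qed

section \<open>Uniformity and the supports of covectors\<close>

lemma triangulation_chirotope_nonzero_iff:
  fixes \<T> :: "((real ^ 'r::{finite,linorder}) \<times> (real ^ 'e::{finite,linorder})) set set"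
  assumes A: "\<forall>i j. A i j \<in> {1, -1}"
  shows "triangulation_chirotope \<T> A ys \<noteq> 0 \<longleftrightarrow> length ys = CARD('r) \<and> distinct ys"
proof -
  have "A i j \<noteq> 0" for i j using A[rule_format, of i j] by auto
  then have "(\<Prod>(i, j)\<in>M. A i j) \<noteq> 0" for M
    by (auto simp: prod_zero_iff split: prod.splits)
  then show ?thesis
    by (simp add: triangulation_chirotope_def alternating_extension_def matching_sign_def)
qed

lemma supp_sv_compose: "supp (sv_compose X Y) = supp X \<union> supp Y"
  by (auto simp: supp_def sv_compose_def)

text \<open>A nonzero generator vanishes exactly on its \<open>d - 1\<close> fixed arguments, and
  composition only enlarges supports.\<close>

lemma covector_support_card:
  fixes \<T> :: "((real ^ 'r::{finite,linorder}) \<times> (real ^ 'e::{finite,linorder})) set set"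
  assumes A: "\<forall>i j. A i j \<in> {1, -1}"
    and Z: "Z \<in> covectors CARD('r) (triangulation_chirotope \<T> A)"
  shows "supp Z \<noteq> {} \<Longrightarrow> CARD('e) - CARD('r) + 1 \<le> card (supp Z)"
  using Z
proof induction
  case zero
  then show ?case by (simp add: supp_def)
next
  case (compose s xs Y)
  let ?X = "\<lambda>e. s * triangulation_chirotope \<T> A (xs @ [e])"
  have X: "supp ?X = (if distinct xs then - set xs else {})"
    using compose.hyps(1,2) triangulation_chirotope_nonzero_iff[OF A, of \<T>]
    by (auto simp: supp_def)
  show ?case
  proof (cases "supp ?X = {}")
    case True
    with compose show ?thesis by (simp add: supp_sv_compose)
  next
    case False
    then have dist: "distinct xs" using X by (cases "distinct xs") simp_all
    then have "supp ?X = - set xs" using X by simp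
    moreover have "card (set xs) = CARD('r) - 1"
      using distinct_card[OF dist] compose.hyps(2) by simp
    ultimately have "card (supp ?X) = CARD('e) - (CARD('r) - 1)"
      by (simp add: Compl_eq_Diff_UNIV card_Diff_subset)
    \<comment> \<open>Positivity excludes truncated subtraction, so \<open>n - (d - 1)\<close>
      equals \<open>n - d + 1\<close>.\<close>
    moreover have "card (supp ?X) > 0" using False by (simp only: card_gt_0_iff finite simp_thms)
    ultimately have "CARD('e) - CARD('r) + 1 \<le> card (supp ?X)"
      using zero_less_card_finite[where 'a = 'r] by linarith
    also have "\<dots> \<le> card (supp (sv_compose ?X Y))"
      by (intro card_mono) (auto simp: supp_sv_compose)
    finally show ?thesis .
  qed
qed

section \<open>Flipping vectors as values of the chirotope\<close>

lemma card_2_eq_insert: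
  assumes "card {i. P i} = 2" "P a" "P b" "a \<noteq> b"
  shows "{i. P i} = {a, b}"
proof -
  have "finite {i. P i}" using assms(1) by (intro card_ge_0_finite) simp
  moreover have "card {a, b} = 2" using assms(4) by simp
  ultimately show ?thesis
    using card_subset_eq[of "{i. P i}" "{a, b}"] assms by simp
qed

text \<open>With only two edges at \<open>j\<close>, the witnesses of different signs must be these
  two.\<close>

lemma alternating_flippings_ends:
  assumes "S \<in> alternating_flippings A G \<rho>" "j \<notin> \<rho>" "degree_E G j = 2"
    and "(i, j) \<in> G" "(i', j) \<in> G" "i \<noteq> i'"
  shows "edge_sign A S i j \<noteq> edge_sign A S i' j"
proof -
  have ends: "{k. (k, j) \<in> G} = {i, i'}"
    by (rule card_2_eq_insert) (use assms in \<open>simp_all add: degree_E_def\<close>)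
  obtain a b where ab: "(a, j) \<in> G" "(b, j) \<in> G" "edge_sign A S a j \<noteq> edge_sign A S b j"
    using assms(1,2) unfolding alternating_flippings_def by blast
  then have "a \<in> {i, i'}" "b \<in> {i, i'}" unfolding ends[symmetric] by simp_all
  with ab(3) show ?thesis by auto
qed

lemma degree_E_1_unique:
  assumes "degree_E G j = 1" "(i, j) \<in> G" "(i', j) \<in> G"
  shows "i = i'"
proof -
  obtain x where "{k. (k, j) \<in> G} = {x}"
    using assms(1) unfolding degree_E_def by (auto simp: card_1_singleton_iff)
  with assms(2,3) have "i \<in> {x}" "i' \<in> {x}" by blast+
  then show ?thesis by simp
qed

text \<open>The term of the permutation \<open>q\<close> in the expansion of the determinant whose columns are the
  columns \<open>xs\<close> of \<open>A\<close> followed by \<open>S\<close>.\<close>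

definition determinant_term ::
    "('r::{finite,linorder} \<Rightarrow> 'e \<Rightarrow> int) \<Rightarrow> 'e list \<Rightarrow> ('r \<Rightarrow> int) \<Rightarrow> ('r \<Rightarrow> nat) \<Rightarrow> int" where
  "determinant_term A xs S q =
     sign (index_perm q) * (\<Prod>i\<in>UNIV. if q i < length xs then A i (xs ! q i) else S i)"

text \<open>The swap moves the root, the node assigned to column \<open>S\<close>, from
  \<open>r\<close> to \<open>r'\<close>. With \<open>j = xs ! q r'\<close>, it replaces
  \<open>S r * A r' j\<close> by \<open>A r j * S r'\<close>, which alternation makes its negative;
  the sign of the permutation changes too.\<close>

lemma determinant_term_transpose:
  fixes q :: "'r::{finite,linorder} \<Rightarrow> nat"
  assumes q: "bij_betw q UNIV {..<CARD('r)}"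
    and r: "\<not> q r < length xs" "q r' < length xs"
    and A: "\<forall>i j. A i j \<in> {1, -1}" and S: "\<And>i. S i \<in> {1, -1}"
    and alt: "edge_sign A S r (xs ! q r') \<noteq> edge_sign A S r' (xs ! q r')"
  shows "determinant_term A xs S (q \<circ> Transposition.transpose r r') = determinant_term A xs S q"
proof -
  have ne: "r \<noteq> r'" using r by auto
  let ?q = "q \<circ> Transposition.transpose r r'"
  define f where "f = (\<lambda>q i. if q i < length xs then A i (xs ! q i) else S i)"
  have split: "(\<Prod>i\<in>UNIV. f p i) = f p r * (f p r' * (\<Prod>i\<in>UNIV - {r} - {r'}. f p i))" for p
    using ne by (simp add: prod.remove[of UNIV r] prod.remove[of "UNIV - {r}" r'])
  have "f ?q r * f ?q r' = - (f q r * f q r')"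
    using r alt A[rule_format, of r "xs ! q r'"] A[rule_format, of r' "xs ! q r'"] S[of r] S[of r']
    by (auto simp: f_def edge_sign_def)
  moreover have "(\<Prod>i\<in>UNIV - {r} - {r'}. f ?q i) = (\<Prod>i\<in>UNIV - {r} - {r'}. f q i)"
    by (intro prod.cong) (auto simp: f_def)
  ultimately have "(\<Prod>i\<in>UNIV. f ?q i) = - (\<Prod>i\<in>UNIV. f q i)"
    unfolding split by (simp add: mult.assoc[symmetric])
  then show ?thesis
    unfolding determinant_term_def f_def sign_index_perm_transpose[OF q ne] by simp
qed

lemma determinant_term_cases:
  assumes A: "\<forall>i j. A i j \<in> {1, -1}" and S: "\<And>i. S i \<in> {1, -1}"
  shows "determinant_term A xs S q \<in> {1, -1}"
proof -
  have "\<bar>if q i < length xs then A i (xs ! q i) else S i\<bar> = 1" for i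
    using A[rule_format, of i "xs ! q i"] S[of i] by auto
  then have "\<bar>\<Prod>i\<in>UNIV. if q i < length xs then A i (xs ! q i) else S i\<bar> = 1"
    by (simp add: abs_prod)
  then have "\<bar>determinant_term A xs S q\<bar> = 1"
    by (simp add: determinant_term_def abs_mult sign_def)
  then show ?thesis by auto
qed

text \<open>Every node can be made the root without changing the determinant term. With the root at
  the neighbour of \<open>e\<close>, this term and the chirotope value differ only in the factor of
  the root.\<close>

lemma flipping_vector_eq_chirotope:
  fixes \<T> :: "((real ^ 'r::{finite,linorder}) \<times> (real ^ 'e::{finite,linorder})) set set"
    and N :: "'r \<Rightarrow> 'e"
  defines "d \<equiv> CARD('r)"
  assumes \<T>: "product_triangulation \<T>" "C \<in> \<T>" and G: "G = cell_tree C"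
    and A: "\<forall>i j. A i j \<in> {1, -1}"
    and deg1: "\<forall>j\<in>\<rho>. degree_E G j = 1"
    and deg2: "\<forall>j. j \<notin> \<rho> \<longrightarrow> degree_E G j = 2"
    and N: "bij_betw N (- {r}) (- \<rho>)" "\<forall>i. i \<noteq> r \<longrightarrow> (i, N i) \<in> G"
    and S: "S \<in> alternating_flippings A G \<rho>"
  obtains c xs where "c \<in> {1, -1}" "length xs = d - 1"
    "flipping_vector A G \<rho> S = (\<lambda>e. c * triangulation_chirotope \<T> A (xs @ [e]))"
proof -
  have d: "d > 0" "Suc (d - 1) = d" unfolding d_def by (simp_all add: zero_less_card_finite)
  define xs where "xs = sorted_list_of_set (- \<rho>)"
  have "card (- \<rho>) = card (- {r})" using N(1) bij_betw_same_card by metis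
  then have len: "length xs = d - 1"
    by (simp add: xs_def d_def Compl_eq_Diff_UNIV card_Diff_subset)
  have xs: "distinct xs" "set xs = - \<rho>" by (simp_all add: xs_def)
  have S1: "S i \<in> {1, -1}" for i
    using S unfolding alternating_flippings_def flippings_def by simp
  have nth: "bij_betw ((!) xs) {..<d - 1} (- \<rho>)"
    by (rule bij_betw_nth) (use xs len in auto)
  define idx where "idx = inv_into {..<d - 1} ((!) xs)"
  have idx: "bij_betw idx (- \<rho>) {..<d - 1}"
    unfolding idx_def by (rule bij_betw_inv_into[OF nth])
  have xs_idx: "xs ! idx j = j" if "j \<notin> \<rho>" for j
    unfolding idx_def using bij_betw_inv_into_right[OF nth] that by simp
  \<comment> \<open>The last slot \<open>d - 1\<close> is reserved for the root; the appended
    element \<open>e\<close> will stand there.\<close>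
  define q0 where "q0 = (\<lambda>i. if i = r then d - 1 else idx (N i))"
  have "bij_betw q0 (- {r}) {..<d - 1}"
    by (rule bij_betw_cong[THEN iffD1, OF _ bij_betw_trans[OF N(1) idx]])
      (simp add: q0_def)
  moreover have "bij_betw q0 {r} {d - 1}" by (simp add: q0_def)
  ultimately have "bij_betw q0 (- {r} \<union> {r}) ({..<d - 1} \<union> {d - 1})"
    by (rule bij_betw_combine) simp
  moreover have "{..<d - 1} \<union> {d - 1} = {..<d}" using d by auto
  moreover have "- {r} \<union> {r} = UNIV" by auto
  ultimately have q0: "bij_betw q0 UNIV {..<d}" by (simp only:)
  define c where "c = determinant_term A xs S q0"
  have c: "c \<in> {1, -1}" unfolding c_def by (rule determinant_term_cases[OF A S1])
  \<comment> \<open>Assignments along edges of \<open>G\<close>, with the last slot free, whose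
    determinant term is that of \<open>q0\<close>.\<close>
  define P where "P = (\<lambda>q. bij_betw q UNIV {..<d} \<and>
      (\<forall>i. q i < d - 1 \<longrightarrow> (i, xs ! q i) \<in> G) \<and> determinant_term A xs S q = c)"
  have Nr: "N i \<notin> \<rho>" if "i \<noteq> r" for i
    using bij_betwE[OF N(1)] that by auto
  have "P q0"
    using q0 N(2) Nr xs_idx unfolding P_def c_def by (auto simp: q0_def)
  moreover have "q0 r = d - 1" by (simp add: q0_def)
  ultimately have r: "r \<in> {i. \<exists>q. P q \<and> q i = d - 1}" by blast
  have root: "\<exists>q. P q \<and> q i = d - 1" for i
  proof -
    have "i \<in> {i. \<exists>q. P q \<and> q i = d - 1}"
    proof (rule R_connectedD[OF cell_tree_R_connected[OF \<T>] r, folded G])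
      fix a b j
      assume ab: "(a, j) \<in> G" "(b, j) \<in> G" and "a \<in> {i. \<exists>q. P q \<and> q i = d - 1}"
      then obtain q where q: "P q" "q a = d - 1" by blast
      show "b \<in> {i. \<exists>q. P q \<and> q i = d - 1}"
      proof (cases "a = b")
        case True
        with q show ?thesis by blast
      next
        case False
        then have j: "j \<notin> \<rho>" using degree_E_1_unique[OF deg1[rule_format] ab] by blast
        have bij: "bij_betw q UNIV {..<d}" using q by (simp add: P_def)
        have l: "idx j < d - 1" using bij_betwE[OF idx] j by auto
        \<comment> \<open>Some node is assigned to \<open>j\<close>. It is \<open>a\<close> or
          \<open>b\<close>, and \<open>a\<close> holds the last slot, so it is \<open>b\<close>;
          swapping \<open>a\<close> and \<open>b\<close> then moves the root to
          \<open>b\<close>.\<close>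
        then have "idx j \<in> q ` UNIV" using bij d by (auto simp: bij_betw_def)
        then obtain k where k: "q k = idx j" by auto
        have "\<forall>i. q i < d - 1 \<longrightarrow> (i, xs ! q i) \<in> G" using q(1) unfolding P_def by blast
        then have "(k, xs ! q k) \<in> G" using k l by metis
        then have "(k, j) \<in> G" by (simp only: k xs_idx[OF j])
        moreover have "{k. (k, j) \<in> G} = {a, b}"
          by (rule card_2_eq_insert) (use deg2[rule_format, OF j] ab False in \<open>simp_all add: degree_E_def\<close>)
        ultimately have "k = a \<or> k = b" by blast
        then have "k = b" using q(2) k l by auto
        with k have qb: "q b = idx j" by simp
        let ?q = "q \<circ> Transposition.transpose a b"
        have "determinant_term A xs S ?q = determinant_term A xs S q"
          using alternating_flippings_ends[OF S j deg2[rule_format, OF j] ab False] q(2) qb l bij xs_idx[OF j]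
          by (intro determinant_term_transpose A S1) (simp_all add: len d_def)
        moreover have "bij_betw ?q UNIV {..<d}"
          by (rule bij_betw_trans[OF _ bij]) (simp add: bij_betw_def)
        moreover have "(i, xs ! ?q i) \<in> G" if "?q i < d - 1" for i
        proof -
          consider "i = a" | "i = b" | "i \<noteq> a" "i \<noteq> b" by blast
          then show ?thesis
          proof cases
            case 1
            then show ?thesis using qb xs_idx[OF j] ab(1) by simp
          next
            case 2
            then show ?thesis using that q(2) by simp
          next
            case 3
            then show ?thesis using that q(1) by (simp add: P_def)
          qed
        qed
        ultimately have "P ?q" using q(1) unfolding P_def by simp
        moreover have "?q b = d - 1" using q(2) by simp
        ultimately show ?thesis by blast
      qed
    qed
    then show ?thesis by simp
  qed
  have "flipping_vector A G \<rho> S e = c * triangulation_chirotope \<T> A (xs @ [e])" for e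
  proof (cases "e \<in> \<rho>")
    case False
    then have "\<not> distinct (xs @ [e])" using xs by simp
    then have "triangulation_chirotope \<T> A (xs @ [e]) = 0"
      unfolding triangulation_chirotope_def alternating_extension_def
      by (simp only: simp_thms if_False)
    with False show ?thesis by (simp add: flipping_vector_def)
  next
    case True
    have "{k. (k, e) \<in> G} \<noteq> {}"
      using deg1[rule_format, OF True] unfolding degree_E_def by force
    then obtain a where a: "(a, e) \<in> G" by auto
    have the: "(THE i. (i, e) \<in> G) = a"
      using a degree_E_1_unique[OF deg1[rule_format, OF True]] by (intro the_equality)
    \<comment> \<open>Rooted at the only neighbour of \<open>e\<close>, the assignment is a perfect
      matching onto all of \<open>?ys\<close> inside the cell.\<close>
    obtain q where q: "P q" "q a = d - 1" using root by blast
    let ?ys = "xs @ [e]"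
    have bij: "bij_betw q UNIV {..<d}" using q(1) by (simp add: P_def)
    have lt: "q i < d - 1" if "i \<noteq> a" for i
    proof -
      have "q i \<noteq> q a" using bij that by (auto simp: bij_betw_def inj_on_def)
      moreover have "q i < d" using bij_betwE[OF bij] by auto
      ultimately show ?thesis using q(2) by linarith
    qed
    have ltx: "q i < length xs" if "i \<noteq> a" for i using lt[OF that] len by simp
    have ysa: "?ys ! q a = e" using q(2) len by (simp add: nth_append)
    have ys: "?ys ! q i = xs ! q i" if "i \<noteq> a" for i
      using lt[OF that] len by (simp add: nth_append)
    have edges: "(i, ?ys ! q i) \<in> cell_tree C" for i
    proof (cases "i = a")
      case True
      then show ?thesis using ysa a G by simp
    next
      case False
      then show ?thesis using ys lt q(1) G by (simp add: P_def)
    qed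
    have chi: "triangulation_chirotope \<T> A ?ys
        = sign (index_perm q) * (\<Prod>i\<in>UNIV. A i (?ys ! q i))"
      by (rule triangulation_chirotope_eq[OF \<T> _ _ _ edges])
        (use True xs len d bij in \<open>simp_all add: d_def\<close>)
    have c_eq: "c = sign (index_perm q)
        * (\<Prod>i\<in>UNIV. if q i < length xs then A i (xs ! q i) else S i)"
      using q(1) by (simp add: P_def determinant_term_def)
    define R where "R = (\<Prod>i\<in>UNIV - {a}. A i (xs ! q i))"
    have "(\<Prod>i\<in>UNIV - {a}. A i (?ys ! q i)) = R"
      unfolding R_def by (intro prod.cong) (simp_all add: ys)
    then have 1: "(\<Prod>i\<in>UNIV. A i (?ys ! q i)) = A a e * R"
      by (simp add: prod.remove[of UNIV a] ysa)
    have "(\<Prod>i\<in>UNIV - {a}. if q i < length xs then A i (xs ! q i) else S i) = R"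
      unfolding R_def by (intro prod.cong) (simp_all add: ltx)
    then have 2: "(\<Prod>i\<in>UNIV. if q i < length xs then A i (xs ! q i) else S i) = S a * R"
      using q(2) by (simp add: prod.remove[of UNIV a] len)
    \<comment> \<open>\<open>R\<close> is the common part of both products. Since \<open>S a\<close>
      squares to 1, it can change sides.\<close>
    have "c = S a * (sign (index_perm q) * R)" using c_eq 2 by (simp add: algebra_simps)
    then have "sign (index_perm q) * R = S a * c" using S1[of a] by auto
    then have "triangulation_chirotope \<T> A ?ys = A a e * (S a * c)"
      unfolding chi 1 by (simp add: algebra_simps)
    moreover have "flipping_vector A G \<rho> S e = S a * A a e"
      using True the by (simp add: flipping_vector_def edge_sign_def)
    moreover have "c * c = 1" using c by auto
    ultimately show ?thesis by (simp add: algebra_simps)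
  qed
  then show ?thesis using that[OF c len] by blast
qed

section \<open>Counting the alternating flippings\<close>

lemma card_alternating_flippings:
  fixes S :: "'r::finite \<Rightarrow> int"
  assumes conn: "R_connected G" and A: "\<forall>i j. A i j \<in> {1, -1}"
    and deg1: "\<forall>j\<in>\<rho>. degree_E G j = 1"
    and deg2: "\<forall>j. j \<notin> \<rho> \<longrightarrow> degree_E G j = 2"
    and S: "S \<in> alternating_flippings A G \<rho>"
  shows "card (alternating_flippings A G \<rho>) = 2"
proof -
  have pm: "S' i \<in> {1, -1}" if "S' \<in> alternating_flippings A G \<rho>" for S' and i :: 'r
    using that unfolding alternating_flippings_def flippings_def by simp
  define r :: 'r where "r = undefined"
  have *: "S' = S \<or> S' = (\<lambda>i. - S i)" if S': "S' \<in> alternating_flippings A G \<rho>" for S'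
  proof -
    \<comment> \<open>For signs the product is the ratio. Both flippings alternate at each node
      outside \<rho>, so the ratio is constant along the connected graph.\<close>
    have "i \<in> {i. S' i * S i = S' r * S r}" for i
    proof (rule R_connectedD[OF conn, of r])
      fix a b j
      assume ab: "(a, j) \<in> G" "(b, j) \<in> G" "a \<in> {i. S' i * S i = S' r * S r}"
      have "S' b * S b = S' a * S a"
      proof (cases "a = b")
        case False
        then have j: "j \<notin> \<rho>" using degree_E_1_unique[OF deg1[rule_format] ab(1,2)] by blast
        show ?thesis
          using alternating_flippings_ends[OF S j deg2[rule_format, OF j] ab(1,2) False]
            alternating_flippings_ends[OF S' j deg2[rule_format, OF j] ab(1,2) False]
            pm[OF S, of a] pm[OF S, of b] pm[OF S', of a] pm[OF S', of b] A[rule_format, of a j] A[rule_format, of b j]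
          by (auto simp: edge_sign_def)
      qed simp
      with ab(3) show "b \<in> {i. S' i * S i = S' r * S r}" by simp
    qed simp
    then have eq: "S' i * S i = S' r * S r" for i by simp
    define k where "k = S' r * S r"
    have "S' i = k * S i" for i
      using eq[of i] pm[OF S, of i] unfolding k_def[symmetric] by auto
    moreover have "k = 1 \<or> k = - 1"
      using pm[OF S, of r] pm[OF S', of r] by (auto simp: k_def)
    ultimately show ?thesis by (auto simp: fun_eq_iff)
  qed
  have neg: "(\<lambda>i. - S i) \<in> alternating_flippings A G \<rho>"
    using S pm[OF S] unfolding alternating_flippings_def flippings_def edge_sign_def by auto
  have "alternating_flippings A G \<rho> = {S, \<lambda>i. - S i}"
    using * S neg by blast
  moreover have "S \<noteq> (\<lambda>i. - S i)"
    using pm[OF S, of r] by (auto simp: fun_eq_iff intro!: exI[of _ r])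
  ultimately show ?thesis by simp
qed

theorem proposition3p20:
  fixes \<T> :: "((real ^ 'r::{finite,linorder}) \<times> (real ^ 'e::{finite,linorder})) set set"
    and A :: "'r \<Rightarrow> 'e \<Rightarrow> int"
    and \<rho> :: "'e set"
    and T\<^sub>\<rho> :: "('r \<times> 'e) set"
  assumes "CARD('r) \<le> CARD('e)"
    and "product_triangulation \<T>"
    and "\<forall>i j. A i j \<in> {1, -1}"
    and "card \<rho> = CARD('e) - CARD('r) + 1"
    and "T\<^sub>\<rho> \<in> cell_tree ` \<T>"
    and "\<forall>j\<in>\<rho>. degree_E T\<^sub>\<rho> j = 1"
    and "\<forall>j. j \<notin> \<rho> \<longrightarrow> degree_E T\<^sub>\<rho> j = 2"
  shows "card (alternating_flippings A T\<^sub>\<rho> \<rho>) = 2 \<and>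
    (\<forall>S\<in>alternating_flippings A T\<^sub>\<rho> \<rho>.
       supp (flipping_vector A T\<^sub>\<rho> \<rho> S) = \<rho> \<and>
       flipping_vector A T\<^sub>\<rho> \<rho> S
         \<in> signed_cocircuits CARD('r) (triangulation_chirotope \<T> A))"
proof -
  let ?G = "T\<^sub>\<rho>"
  obtain C where C: "C \<in> \<T>" "?G = cell_tree C" using assms(5) by blast
  note A = assms(3)
  note deg1 = assms(6) and deg2 = assms(7)
  have deg: "degree_E ?G j \<le> 2" for j using deg1 deg2 by (cases "j \<in> \<rho>") simp_all
  have conn: "R_connected ?G" unfolding C(2) by (rule cell_tree_R_connected[OF assms(2) C(1)])
  define r :: 'r where "r = undefined"
  obtain N S\<^sub>0 where S0: "S\<^sub>0 \<in> flippings" and inj: "inj_on N (- {r})"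
    and NS: "\<forall>i. i \<noteq> r \<longrightarrow> (i, N i) \<in> ?G \<and> (\<exists>a b. (a, N i) \<in> ?G \<and> (b, N i) \<in> ?G \<and>
        edge_sign A S\<^sub>0 a (N i) \<noteq> edge_sign A S\<^sub>0 b (N i))"
    using rooted_matching_with_alternating_flipping[OF conn deg A, of r] by (elim exE conjE)
  have NG: "\<forall>i. i \<noteq> r \<longrightarrow> (i, N i) \<in> ?G" using NS by simp
  have alt: "\<exists>a b. (a, N i) \<in> ?G \<and> (b, N i) \<in> ?G \<and>
      edge_sign A S\<^sub>0 a (N i) \<noteq> edge_sign A S\<^sub>0 b (N i)" if "i \<noteq> r" for i
    using NS that by simp
  \<comment> \<open>Two different signs occur at \<open>N i\<close>, so it is not a leaf.\<close>
  have "N i \<notin> \<rho>" if "i \<noteq> r" for i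
    using alt[OF that] degree_E_1_unique[OF deg1[rule_format]] by metis
  then have "N ` (- {r}) \<subseteq> - \<rho>" by auto
  \<comment> \<open>Both sides are \<open>d - 1\<close>, so the injective \<open>N\<close> exhausts
    the complement of \<rho>.\<close>
  moreover have "card (N ` (- {r})) = card (- \<rho>)"
    unfolding card_image[OF inj] using assms(1,4) zero_less_card_finite[where 'a = 'r]
    by (simp add: Compl_eq_Diff_UNIV card_Diff_subset)
  ultimately have "N ` (- {r}) = - \<rho>" by (intro card_subset_eq) simp_all
  with inj have N: "bij_betw N (- {r}) (- \<rho>)" by (simp add: bij_betw_def)
  have "\<exists>a b. (a, j) \<in> ?G \<and> (b, j) \<in> ?G \<and> edge_sign A S\<^sub>0 a j \<noteq> edge_sign A S\<^sub>0 b j"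
    if "j \<notin> \<rho>" for j
  proof -
    have "j \<in> N ` (- {r})" using that \<open>N ` (- {r}) = - \<rho>\<close> by simp
    then obtain i where "i \<noteq> r" "j = N i" by auto
    then show ?thesis using alt by simp
  qed
  then have "S\<^sub>0 \<in> alternating_flippings A ?G \<rho>"
    using S0 by (simp add: alternating_flippings_def)
  then have "card (alternating_flippings A ?G \<rho>) = 2"
    by (rule card_alternating_flippings[OF conn A deg1 deg2])
  moreover have "supp (flipping_vector A ?G \<rho> S) = \<rho> \<and>
      flipping_vector A ?G \<rho> S \<in> signed_cocircuits CARD('r) (triangulation_chirotope \<T> A)"
    if S: "S \<in> alternating_flippings A ?G \<rho>" for S
  proof -
    let ?X = "flipping_vector A ?G \<rho> S" and ?cov = "covectors CARD('r) (triangulation_chirotope \<T> A)"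
    have "edge_sign A S i j \<noteq> 0" for i j
    proof -
      have "S i \<in> {1, -1}" using S unfolding alternating_flippings_def flippings_def by simp
      with A[rule_format, of i j] show ?thesis by (auto simp: edge_sign_def)
    qed
    then have supp: "supp ?X = \<rho>" by (auto simp: supp_def flipping_vector_def)
    obtain c xs where cxs: "c \<in> {1, -1}" "length xs = CARD('r) - 1"
      "?X = (\<lambda>e. c * triangulation_chirotope \<T> A (xs @ [e]))"
      using flipping_vector_eq_chirotope[OF assms(2) C(1,2) A deg1 deg2 N NG S] by blast
    \<comment> \<open>A single generator is a covector as its composition with the zero
      vector.\<close>
    have "sv_compose (\<lambda>e. c * triangulation_chirotope \<T> A (xs @ [e])) (\<lambda>_. 0) \<in> ?cov"
      by (intro covectors.intros cxs)
    moreover have "sv_compose Y (\<lambda>_. 0) = Y" for Y :: "'e \<Rightarrow> int"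
      by (auto simp: sv_compose_def)
    ultimately have "?X \<in> ?cov" unfolding cxs(3) by simp
    \<comment> \<open>The lower bound on supports of nonzero covectors is exactly the size of
      \<rho>, so no smaller support fits inside.\<close>
    moreover have "supp Z = supp ?X" if Z: "Z \<in> ?cov" "supp Z \<noteq> {}" "supp Z \<subseteq> supp ?X" for Z
      using covector_support_card[OF A Z(1,2)] Z(3) assms(4) unfolding supp
      by (intro card_seteq) simp_all
    moreover have "supp ?X \<noteq> {}" unfolding supp using assms(4) by auto
    ultimately have "?X \<in> signed_cocircuits CARD('r) (triangulation_chirotope \<T> A)"
      unfolding signed_cocircuits_def by blast
    with supp show ?thesis by blast
  qed
  ultimately show ?thesis by blast
qed

end
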